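(* Let $m\ge2$, let $C_n\in\mathbb{R}^{m\times m}$ be a (symmetric) sample covariance matrix, let $\alpha>0$ and let $\delta_n>0$. Then the problem rLogSpecT with data $C_n$, $\delta_n$, $\alpha$ has a nontrivial (i.e. nonzero) feasible solution.
   Context: $\mathcal{S}:=\{S\in\mathbb{R}^{m\times m}: S=S^\top,\ \operatorname{diag}(S)=0,\ S\ge 0 \text{ entrywise}\}$. The problem rLogSpecT is $$\min_{S}\ \|S\|_{1,1}-\alpha\,\mathbf{1}^\top\log(S\mathbf{1})\quad\text{s.t.}\quad S\in\mathcal{S},\ \|SC_n-C_nS\|_F^2\le\delta_n^2,$$ where $\|S\|_{1,1}=\sum_{i,j}|S_{ij}|$, $\|\cdot\|_F$ is the Frobenius norm, $\mathbf{1}$ is the all-ones vector and $\log$ is applied entrywise. A feasible solution is a matrix $S$ satisfying the constraints and lying in the domain of the objective, i.e. with $(S\mathbf{1})_i>0$ for all $i$. *)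

theory Defs
  imports "HOL-Analysis.Analysis"
begin

definition weight_matrices :: "(real ^ 'm ^ 'm) set" where
  "weight_matrices =
     {S. transpose S = S \<and> (\<forall>i. S $ i $ i = 0) \<and> (\<forall>i j. 0 \<le> S $ i $ j)}"

definition norm_1_1 :: "real ^ 'n ^ 'm \<Rightarrow> real" where
  "norm_1_1 S = (\<Sum>i\<in>UNIV. \<Sum>j\<in>UNIV. \<bar>S $ i $ j\<bar>)"

text \<open>
  The logarithm as a concave extended-valued function on the real line: it is minus infinity
  at nonpositive arguments, whereas the library's \<^const>\<open>ln\<close> is total and real-valued.
\<close>

definition elog :: "real \<Rightarrow> ereal" where
  "elog x = (if 0 < x then ereal (ln x) else - \<infinity>)"

definition rLogSpecT_objective :: "real \<Rightarrow> real ^ 'm ^ 'm \<Rightarrow> ereal" where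
  "rLogSpecT_objective \<alpha> S =
     ereal (norm_1_1 S) - ereal \<alpha> * (\<Sum>i\<in>UNIV. elog ((S *v 1) $ i))"

definition rLogSpecT_domain :: "real \<Rightarrow> (real ^ 'm ^ 'm) set" where
  "rLogSpecT_domain \<alpha> = {S. rLogSpecT_objective \<alpha> S < \<infinity>}"

text \<open>
  The library norm on the type of real matrices is the Frobenius norm, see
  \<open>norm_matrix_Frobenius\<close> below.
\<close>

definition rLogSpecT_constraints :: "real ^ 'm ^ 'm \<Rightarrow> real \<Rightarrow> (real ^ 'm ^ 'm) set" where
  "rLogSpecT_constraints C \<delta> =
     {S \<in> weight_matrices. (norm (S ** C - C ** S))\<^sup>2 \<le> \<delta>\<^sup>2}"

definition rLogSpecT_feasible ::
    "real ^ 'm ^ 'm \<Rightarrow> real \<Rightarrow> real \<Rightarrow> real ^ 'm ^ 'm \<Rightarrow> bool" where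
  "rLogSpecT_feasible C \<delta> \<alpha> S \<longleftrightarrow>
     S \<in> rLogSpecT_constraints C \<delta> \<and> S \<in> rLogSpecT_domain \<alpha>"

lemma norm_matrix_Frobenius:
  fixes A :: "real ^ 'n ^ 'm"
  shows "norm A = sqrt (\<Sum>i\<in>UNIV. \<Sum>j\<in>UNIV. (A $ i $ j)\<^sup>2)"
  by (simp add: norm_vec_def L2_set_def sum_nonneg)

lemma sum_elog:
  assumes "finite I"
  shows "(\<Sum>i\<in>I. elog (f i)) =
           (if \<forall>i\<in>I. 0 < f i then ereal (\<Sum>i\<in>I. ln (f i)) else - \<infinity>)"
  using assms by (induction I rule: finite_induct) (auto simp: elog_def)

lemma rLogSpecT_objective_eq:
  fixes S :: "real ^ 'm ^ 'm"
  assumes "0 < \<alpha>"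
  shows "rLogSpecT_objective \<alpha> S =
           (if \<forall>i. 0 < (S *v 1) $ i
            then ereal (norm_1_1 S - \<alpha> * (\<Sum>i\<in>UNIV. ln ((S *v 1) $ i))) else \<infinity>)"
  using assms unfolding rLogSpecT_objective_def by (subst sum_elog) auto

lemma rLogSpecT_domain_eq:
  assumes "0 < \<alpha>"
  shows "rLogSpecT_domain \<alpha> = {S. \<forall>i. 0 < (S *v 1) $ i}"
  using assms by (auto simp: rLogSpecT_domain_def rLogSpecT_objective_eq)

end

theory Submission
  imports Defs
begin

text \<open>
  Since the commutator with \<open>C\<close> is linear in \<open>S\<close>, a sufficiently small positive multiple of
  any weight matrix with positive row sums is feasible. The adjacency matrix of the complete
  graph is such a matrix when there are at least two vertices.
\<close>

lemma weight_matrices_scaleR: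
  assumes "S \<in> weight_matrices" "0 \<le> c"
  shows "c *\<^sub>R S \<in> weight_matrices"
  using assms by (auto simp: weight_matrices_def transpose_def vec_eq_iff)

text \<open>The weight matrices and the positivity of row sums are stable under positive scaling, so
  the commutator bound alone decides how small \<open>c\<close> has to be.\<close>

lemma rLogSpecT_feasible_scaleR:
  fixes C S :: "real ^ 'm ^ 'm"
  assumes S: "S \<in> weight_matrices" and pos: "\<And>i. 0 < (S *v 1) $ i"
    and "0 < \<alpha>" "0 < \<delta>"
  obtains c where "0 < c" "rLogSpecT_feasible C \<delta> \<alpha> (c *\<^sub>R S)"
proof
  define K where "K = norm (S ** C - C ** S)"
  \<comment> \<open>The summand 1 keeps the denominator positive even if \<open>S\<close> commutes
    with \<open>C\<close>, and still \<open>c * K\<close> = \<delta> * K / (K + 1) \<le>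
    \<delta>.\<close>
  define c where "c = \<delta> / (K + 1)"
  have "0 \<le> K" by (simp add: K_def)
  then show "0 < c" using \<open>0 < \<delta>\<close> by (simp add: c_def)
  have "(c *\<^sub>R S) ** C - C ** (c *\<^sub>R S) = c *\<^sub>R (S ** C - C ** S)"
    by (simp add: vec_eq_iff matrix_matrix_mult_def sum_distrib_left algebra_simps)
  then have "norm ((c *\<^sub>R S) ** C - C ** (c *\<^sub>R S)) = c * K"
    using \<open>0 < c\<close> by (simp add: K_def)
  also have "\<dots> \<le> \<delta>"
    using \<open>0 \<le> K\<close> \<open>0 < \<delta>\<close> by (simp add: c_def field_simps)
  finally have "(norm ((c *\<^sub>R S) ** C - C ** (c *\<^sub>R S)))\<^sup>2 \<le> \<delta>\<^sup>2"
    by (intro power_mono) auto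
  \<comment> \<open>As \<alpha> > 0, lying in the domain of the objective amounts to positive row
    sums.\<close>
  moreover have "0 < ((c *\<^sub>R S) *v 1) $ i" for i
    using pos[of i] \<open>0 < c\<close> by (simp add: scaleR_matrix_vector_assoc [symmetric])
  ultimately show "rLogSpecT_feasible C \<delta> \<alpha> (c *\<^sub>R S)"
    using weight_matrices_scaleR[OF S] \<open>0 < c\<close> \<open>0 < \<alpha>\<close>
    by (simp add: rLogSpecT_feasible_def rLogSpecT_constraints_def rLogSpecT_domain_eq)
qed

theorem proposition3p6:
  fixes C :: "real ^ 'm ^ 'm" and \<alpha> \<delta> :: real
  assumes "2 \<le> CARD('m)"
    and "transpose C = C"
    and "0 < \<alpha>"
    and "0 < \<delta>"
  shows "\<exists>S :: real ^ 'm ^ 'm. rLogSpecT_feasible C \<delta> \<alpha> S \<and> S \<noteq> 0"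
proof -
  define J :: "real ^ 'm ^ 'm" where "J = (\<chi> i j. if i = j then 0 else 1)"
  have "J \<in> weight_matrices"
    by (auto simp: weight_matrices_def J_def transpose_def vec_eq_iff)
  moreover have pos: "0 < (J *v 1) $ i" for i
  proof -
    have "(J *v 1) $ i = (\<Sum>j\<in>UNIV. if i = j then 0 else 1)"
      by (simp add: matrix_vector_mult_def J_def)
    also have "\<dots> = (\<Sum>j\<in>UNIV - {i}. 1)"
      by (rule sum.mono_neutral_cong_right) auto
    \<comment> \<open>The subtraction is on naturals; the bound of two on the number of vertices
      makes the result positive.\<close>
    also have "\<dots> = real (CARD('m) - 1)"
      by (simp add: card_Diff_singleton)
    finally show ?thesis using assms(1) by simp
  qed
  ultimately obtain c where "0 < c" "rLogSpecT_feasible C \<delta> \<alpha> (c *\<^sub>R J)"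
    using rLogSpecT_feasible_scaleR assms(3,4) by blast
  \<comment> \<open>The zero matrix has zero row sums; since \<open>c\<close> > 0, the scaled
    \<open>J\<close> is nonzero as well.\<close>
  moreover have "J \<noteq> 0" using pos by fastforce
  ultimately show ?thesis by auto
qed

end
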